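(* For any constant $c>0$ and all large enough $n$, there is a symmetric multiset $S\subseteq\mathbb{F}_2^n$ such that $\lambda(C(\mathbb{F}_2^n,S))\leq \frac{1}{n^c}$, but there is a subspace $L$ of $\mathbb{F}_2^n$ of dimension $n/2$ such that $S\subseteq B(L,20c\log n)$.
   Context: A multiset $S$ of elements of a group is symmetric if there is a bijection of multisets $\varphi:S\to S$ with $\varphi(s)=s^{-1}$. The Cayley graph $C(\mathcal{H},S)$ is the undirected multigraph with vertex set $\mathcal{H}$ and an edge $\{x,xs\}$ for each $x\in\mathcal{H}$ and each $s\in S$ (with multiplicity; edges $(x,xs)$ and $(xs,xs\varphi(s))$ identified); it is $|S|$-regular. $\lambda(C(\mathcal{H},S))$ denotes the second largest absolute value among the eigenvalues of the adjacency matrix, divided by the degree $|S|$. For $x\in\mathbb{F}_2^n$, $wt(x)$ is its Hamming weight; $B(L,r)=\{u+x: u\in L, wt(x)\leq r\}$, the set of points at Hamming distance at most $r$ from $L$. *)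

theory Defs
  imports
    Complex_Main
    "HOL-Library.Multiset"
    "HOL-Library.Z2"
    "HOL-Algebra.Group"
    "HOL-Computational_Algebra.Polynomial"
    "Jordan_Normal_Form.Char_Poly"
    "Jordan_Normal_Form.VS_Connect"
begin

text \<open>A bijection of the multiset \<open>S\<close> onto itself that sends every occurrence of \<open>s\<close> to an
  occurrence of the inverse of \<open>s\<close> exists iff the image of \<open>S\<close> under inversion, taken with
  multiplicities, is \<open>S\<close>.\<close>

definition symmetric_mset :: "('a, 'b) monoid_scheme \<Rightarrow> 'a multiset \<Rightarrow> bool" where
  "symmetric_mset H S \<longleftrightarrow>
     set_mset S \<subseteq> carrier H \<and> image_mset (\<lambda>s. inv\<^bsub>H\<^esub> s) S = S"

text \<open>Number of edges of the undirected multigraph \<open>C(H,S)\<close> between \<open>x\<close> and \<open>y\<close>. After the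
  identification of \<open>(x, xs)\<close> with \<open>(xs, xs\<phi>(s))\<close>, the edges at \<open>x\<close> correspond to the occurrences
  of elements of \<open>S\<close>; an occurrence of the identity contributes a loop counted once, so that the
  graph is regular of degree \<open>size S\<close>.\<close>

definition cayley_edges :: "('a, 'b) monoid_scheme \<Rightarrow> 'a multiset \<Rightarrow> 'a \<Rightarrow> 'a \<Rightarrow> nat" where
  "cayley_edges H S x y = size {# s \<in># S. x \<otimes>\<^bsub>H\<^esub> s = y #}"

text \<open>Matrices are indexed by natural numbers, so the vertices of the finite group \<open>H\<close> are listed
  in an arbitrary order; the choice affects the adjacency matrix only by a simultaneous
  permutation of rows and columns.\<close>

definition vertex_list :: "('a, 'b) monoid_scheme \<Rightarrow> 'a list" where
  "vertex_list H = (SOME vs. distinct vs \<and> set vs = carrier H)"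

definition cayley_adj_mat :: "('a, 'b) monoid_scheme \<Rightarrow> 'a multiset \<Rightarrow> complex mat" where
  "cayley_adj_mat H S =
     (let vs = vertex_list H
      in mat (length vs) (length vs) (\<lambda>(i, j). of_nat (cayley_edges H S (vs ! i) (vs ! j))))"

text \<open>Eigenvalues are counted with their multiplicity as roots of the characteristic polynomial,
  so \<open>cayley_lambda H S = 1\<close> when the graph is disconnected or bipartite. The definition is
  meaningful only for a finite \<open>H\<close> with at least two elements and a nonempty \<open>S\<close>.\<close>

definition eigenvalue_abs_mset :: "complex mat \<Rightarrow> real multiset" where
  "eigenvalue_abs_mset A = image_mset cmod (proots (char_poly A))"

definition second_largest :: "real multiset \<Rightarrow> real" where
  "second_largest M = rev (sorted_list_of_multiset M) ! 1"

definition cayley_lambda :: "('a, 'b) monoid_scheme \<Rightarrow> 'a multiset \<Rightarrow> real" where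
  "cayley_lambda H S =
     second_largest (eigenvalue_abs_mset (cayley_adj_mat H S)) / real (size S)"

abbreviation F2_group :: "nat \<Rightarrow> bit vec monoid" where
  "F2_group n \<equiv> monoid_vec TYPE(bit) n"

abbreviation F2_space :: "nat \<Rightarrow> (bit, bit vec) module" where
  "F2_space n \<equiv> module_vec TYPE(bit) n"

definition F2_subspace :: "nat \<Rightarrow> bit vec set \<Rightarrow> bool" where
  "F2_subspace n L \<longleftrightarrow> VectorSpace.subspace class_ring L (F2_space n)"

definition F2_dim :: "nat \<Rightarrow> bit vec set \<Rightarrow> nat" where
  "F2_dim n L = vectorspace.dim class_ring (F2_space n\<lparr>carrier := L\<rparr>)"

definition wt :: "bit vec \<Rightarrow> nat" where
  "wt x = card {i. i < dim_vec x \<and> x $ i \<noteq> 0}"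

definition F2_nbhd :: "nat \<Rightarrow> bit vec set \<Rightarrow> real \<Rightarrow> bit vec set" where
  "F2_nbhd n L r = {u + x | u x. u \<in> L \<and> x \<in> carrier_vec n \<and> real (wt x) \<le> r}"

end

theory Submission
  imports Defs "Jordan_Normal_Form.DL_Rank"
begin

text \<open>The eigenvalues of \<open>C(F\<^sub>2\<^sup>n, S)\<close> are the character sums \<open>\<Sum>s\<in>S. (-1)\<^bsup>a\<bullet>s\<^esup>\<close>. Take for
  \<open>S\<close> all sums of an element of \<open>L\<close> and the endpoint of an \<open>r\<close>-step lazy walk on the hypercube,
  \<open>r = \<lfloor>20 c ln n\<rfloor>\<close>. The character sum at \<open>a\<close> vanishes unless \<open>a\<close> is orthogonal to \<open>L\<close>, and then it
  is \<open>(1 - wt a / n)\<^sup>r\<close> times the degree. So it suffices that the dual code of \<open>L\<close> has minimum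
  distance at least \<open>n/16\<close>, which a derandomized Gilbert--Varshamov argument achieves in dimension
  \<open>n/2\<close>: choose basis vectors of \<open>L\<close> one at a time, each halving the set of low-weight vectors
  still orthogonal to \<open>L\<close>.\<close>

section \<open>Characters of F_2^n and their orthogonality\<close>

definition chi :: "bit vec \<Rightarrow> bit vec \<Rightarrow> real" where
  "chi a x = (if a \<bullet> x = 0 then 1 else - 1)"

definition char_sum :: "bit vec \<Rightarrow> bit vec multiset \<Rightarrow> real" where
  "char_sum a S = (\<Sum>x\<in>#S. chi a x)"

lemma abs_chi [simp]: "\<bar>chi a x\<bar> = 1"
  by (simp add: chi_def)

lemma chi_commute: "a \<in> carrier_vec n \<Longrightarrow> x \<in> carrier_vec n \<Longrightarrow> chi a x = chi x a"
  unfolding chi_def by (metis comm_scalar_prod)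

lemma chi_add_right:
  assumes "a \<in> carrier_vec n" "x \<in> carrier_vec n" "y \<in> carrier_vec n"
  shows "chi a (x + y) = chi a x * chi a y"
  unfolding chi_def scalar_prod_add_distrib[OF assms]
  by (cases "a \<bullet> x"; cases "a \<bullet> y") simp_all

lemma chi_add_left:
  assumes "a \<in> carrier_vec n" "b \<in> carrier_vec n" "x \<in> carrier_vec n"
  shows "chi (a + b) x = chi a x * chi b x"
  using assms by (metis add_carrier_vec chi_add_right chi_commute)

lemma chi_zero_left [simp]: "x \<in> carrier_vec n \<Longrightarrow> chi (0\<^sub>v n) x = 1"
  by (simp add: chi_def)

lemma chi_zero_right [simp]: "x \<in> carrier_vec n \<Longrightarrow> chi x (0\<^sub>v n) = 1"
  by (simp add: chi_def)

lemma bit_vec_add_self [simp]: "x \<in> carrier_vec n \<Longrightarrow> (x :: bit vec) + x = 0\<^sub>v n"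
  by (intro eq_vecI) simp_all

lemma bit_vec_add_eq_0_iff:
  assumes "x \<in> carrier_vec n" "y \<in> carrier_vec n"
  shows "(x :: bit vec) + y = 0\<^sub>v n \<longleftrightarrow> x = y"
proof
  assume "x + y = 0\<^sub>v n"
  then have "x $ i + y $ i = 0" if "i < n" for i
    using that assms by (metis carrier_vecD index_add_vec(1) index_zero_vec(1))
  then have "x $ i = y $ i" if "i < n" for i
    using that by (cases "x $ i"; cases "y $ i") fastforce+
  then show "x = y" using assms by (intro eq_vecI) auto
qed (use assms in simp)

text \<open>A bit is determined by whether it is nonzero, so a vector is determined by its support.
  This gives finiteness of \<open>carrier_vec n\<close> and later turns sums over vectors into sums
  over sets.\<close>

lemma inj_on_support: "inj_on (\<lambda>x :: bit vec. {i. i < dim_vec x \<and> x $ i \<noteq> 0}) (carrier_vec n)"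
proof (rule inj_onI)
  fix x y :: "bit vec"
  assume c: "x \<in> carrier_vec n" "y \<in> carrier_vec n"
    and e: "{i. i < dim_vec x \<and> x $ i \<noteq> 0} = {i. i < dim_vec y \<and> y $ i \<noteq> 0}"
  have "x $ i = y $ i" if "i < n" for i
  proof -
    have "x $ i \<noteq> 0 \<longleftrightarrow> y $ i \<noteq> 0" using e c that by auto
    then show ?thesis by (cases "x $ i"; cases "y $ i") auto
  qed
  then show "x = y" using c by (intro eq_vecI) auto
qed

lemma finite_carrier_bit_vec [simp]: "finite (carrier_vec n :: bit vec set)"
proof (rule inj_on_finite[OF inj_on_support])
  show "(\<lambda>x :: bit vec. {i. i < dim_vec x \<and> x $ i \<noteq> 0}) ` carrier_vec n \<subseteq> Pow {..<n}" by auto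
qed simp

text \<open>Translation by \<open>u\<close> is an involution of \<open>L\<close> that flips the sign
  of every term.\<close>

lemma sum_chi_eq_0:
  assumes L: "L \<subseteq> carrier_vec n" "\<And>x y. x \<in> L \<Longrightarrow> y \<in> L \<Longrightarrow> x + y \<in> L"
    and a: "a \<in> carrier_vec n" and u: "u \<in> L" "a \<bullet> u \<noteq> 0"
  shows "(\<Sum>x\<in>L. chi a x) = 0"
proof -
  have inv: "u + (u + x) = x" if "x \<in> L" for x
    using that L u by (metis (no_types, lifting) assoc_add_vec bit_vec_add_self left_zero_vec subsetD)
  have "(\<Sum>x\<in>L. chi a x) = (\<Sum>x\<in>L. chi a (u + x))"
    by (rule sum.reindex_bij_witness[where i="\<lambda>x. u + x" and j="\<lambda>x. u + x"])
       (use inv L u in auto)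
  also have "\<dots> = (\<Sum>x\<in>L. - chi a x)"
  proof (rule sum.cong[OF refl])
    fix x assume "x \<in> L"
    then have "chi a (u + x) = chi a u * chi a x"
      using L u a by (intro chi_add_right) auto
    also have "chi a u = - 1" using u by (simp add: chi_def)
    finally show "chi a (u + x) = - chi a x" by simp
  qed
  also have "\<dots> = - (\<Sum>x\<in>L. chi a x)" by (simp add: sum_negf)
  finally show ?thesis by simp
qed

lemma exists_scalar_prod_neq_0:
  assumes "a \<in> carrier_vec n" "(a :: bit vec) \<noteq> 0\<^sub>v n"
  obtains u where "u \<in> carrier_vec n" "a \<bullet> u \<noteq> 0"
proof -
  obtain i where i: "i < n" "a $ i \<noteq> 0"
    using assms by (metis carrier_vecD eq_vecI index_zero_vec)
  show thesis
    by (rule that[of "unit_vec n i"]) (use i assms in auto)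
qed

lemma sum_chi_carrier_vec:
  assumes "a \<in> carrier_vec n"
  shows "(\<Sum>x\<in>carrier_vec n. chi a x) = (if a = 0\<^sub>v n then real (card (carrier_vec n :: bit vec set)) else 0)"
proof (cases "a = 0\<^sub>v n")
  case False
  then obtain u where "u \<in> carrier_vec n" "a \<bullet> u \<noteq> 0"
    using assms exists_scalar_prod_neq_0 by blast
  then show ?thesis using False assms by (simp add: sum_chi_eq_0[of "carrier_vec n" n])
qed simp

section \<open>Character sums of multisets and convolution\<close>

lemma char_sum_empty [simp]: "char_sum a {#} = 0"
  and char_sum_add_mset [simp]: "char_sum a (add_mset x S) = chi a x + char_sum a S"
  and char_sum_union [simp]: "char_sum a (S + T) = char_sum a S + char_sum a T"
  by (simp_all add: char_sum_def)

lemma char_sum_mset_set [simp]: "char_sum a (mset_set A) = (\<Sum>x\<in>A. chi a x)"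
  by (simp add: char_sum_def sum_unfold_sum_mset)

lemma char_sum_zero:
  "set_mset S \<subseteq> carrier_vec n \<Longrightarrow> char_sum (0\<^sub>v n) S = real (size S)"
  by (induction S) auto

lemma abs_char_sum_le: "\<bar>char_sum a S\<bar> \<le> real (size S)"
proof (induction S)
  case (add x S)
  have "\<bar>chi a x + char_sum a S\<bar> \<le> \<bar>chi a x\<bar> + \<bar>char_sum a S\<bar>" by (rule abs_triangle_ineq)
  with add show ?case by simp
qed simp

text \<open>Convolution of multisets: sums are kept with their multiplicity, so that character sums
  become multiplicative.\<close>

definition mset_conv :: "bit vec multiset \<Rightarrow> bit vec multiset \<Rightarrow> bit vec multiset" where
  "mset_conv S T = (\<Sum>x\<in>#S. image_mset (\<lambda>y. x + y) T)"

lemma mset_conv_empty [simp]: "mset_conv {#} T = {#}"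
  and mset_conv_add_mset [simp]:
    "mset_conv (add_mset x S) T = image_mset (\<lambda>y. x + y) T + mset_conv S T"
  by (simp_all add: mset_conv_def)

lemma size_mset_conv [simp]: "size (mset_conv S T) = size S * size T"
  by (induction S) auto

lemma set_mset_conv: "set_mset (mset_conv S T) = {x + y | x y. x \<in># S \<and> y \<in># T}"
  by (induction S) auto

lemma char_sum_mset_conv:
  assumes "a \<in> carrier_vec n" "set_mset S \<subseteq> carrier_vec n" "set_mset T \<subseteq> carrier_vec n"
  shows "char_sum a (mset_conv S T) = char_sum a S * char_sum a T"
  using assms(2)
proof (induction S)
  case (add x S)
  have "char_sum a (image_mset (\<lambda>y. x + y) T) = chi a x * char_sum a T"
    using assms(3)
  proof (induction T)
    case (add y T)
    then show ?case
      using assms(1) \<open>set_mset (add_mset x S) \<subseteq> carrier_vec n\<close>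
      by (simp add: chi_add_right[of a n] algebra_simps)
  qed simp
  with add show ?case by (simp add: algebra_simps)
qed simp

section \<open>The lazy walk on the hypercube\<close>

text \<open>The \<open>n\<close> copies of zero make the walk stay put half of the time. They turn
  the character sum \<open>n - 2 * wt a\<close>, which is large in absolute value also for weights
  near \<open>n\<close>, into \<open>2 * (n - wt a)\<close>, which is nonnegative and decreases with
  the weight.\<close>

definition lazy_step_mset :: "nat \<Rightarrow> bit vec multiset" where
  "lazy_step_mset n = image_mset (unit_vec n) (mset_set {..<n}) + replicate_mset n (0\<^sub>v n)"

lemma set_lazy_step_mset: "set_mset (lazy_step_mset n) \<subseteq> carrier_vec n"
  by (auto simp: lazy_step_mset_def split: if_splits)

lemma size_lazy_step_mset [simp]: "size (lazy_step_mset n) = 2 * n"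
  by (simp add: lazy_step_mset_def)

lemma char_sum_lazy_step_mset:
  assumes a: "a \<in> carrier_vec n"
  shows "char_sum a (lazy_step_mset n) = 2 * (real n - real (wt a))"
proof -
  have "char_sum a (image_mset (unit_vec n) (mset_set {..<n})) = (\<Sum>i<n. chi a (unit_vec n i))"
    by (simp add: char_sum_def sum_unfold_sum_mset multiset.map_comp comp_def)
  also have "\<dots> = (\<Sum>i<n. 1 - 2 * (if a $ i \<noteq> 0 then 1 else 0))"
    using a by (intro sum.cong) (auto simp: chi_def)
  also have "\<dots> = real n - 2 * (\<Sum>i<n. if a $ i \<noteq> 0 then 1 else 0)"
    by (simp only: sum_subtractf sum_distrib_left) simp
  also have "(\<Sum>i<n. if a $ i \<noteq> 0 then 1 else 0) = real (card {i \<in> {..<n}. a $ i \<noteq> 0})"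
    by (subst sum.inter_filter[symmetric]) auto
  also have "{i \<in> {..<n}. a $ i \<noteq> 0} = {i. i < dim_vec a \<and> a $ i \<noteq> 0}"
    using a by auto
  finally have 1: "char_sum a (image_mset (unit_vec n) (mset_set {..<n})) = real n - 2 * real (wt a)"
    by (simp add: wt_def)
  have "char_sum a (replicate_mset m (0\<^sub>v n)) = real m" for m
    using a by (induction m) auto
  with 1 show ?thesis by (simp add: lazy_step_mset_def)
qed

lemma wt_le: "x \<in> carrier_vec n \<Longrightarrow> wt x \<le> n"
  unfolding wt_def using card_mono[of "{..<n}" "{i. i < dim_vec x \<and> x $ i \<noteq> 0}"] by force

lemma wt_add_le:
  assumes "x \<in> carrier_vec n" "y \<in> carrier_vec n"
  shows "wt (x + y) \<le> wt x + wt y"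
proof -
  have "wt (x + y) \<le> card ({i. i < dim_vec x \<and> x $ i \<noteq> 0} \<union> {i. i < dim_vec y \<and> y $ i \<noteq> 0})"
    unfolding wt_def by (rule card_mono) (use assms in \<open>auto simp del: bit_not_zero_iff add_bit_eq_xor\<close>)
  also have "\<dots> \<le> wt x + wt y" unfolding wt_def by (rule card_Un_le)
  finally show ?thesis .
qed

lemma wt_lazy_step_mset:
  assumes "x \<in># lazy_step_mset n"
  shows "wt x \<le> 1"
proof -
  have "{j. j < n \<and> (unit_vec n i :: bit vec) $ j \<noteq> 0} \<subseteq> {i}" for i
    by (auto simp: unit_vec_def split: if_splits)
  then have "wt (unit_vec n i) \<le> 1" for i
    using card_mono[of "{i}" "{j. j < n \<and> (unit_vec n i :: bit vec) $ j \<noteq> 0}"]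
    by (simp add: wt_def)
  moreover have "wt (0\<^sub>v n) = 0" by (simp add: wt_def)
  ultimately show ?thesis
    using assms by (auto simp: lazy_step_mset_def split: if_splits)
qed

text \<open>Endpoints of all walks of \<open>r\<close> steps from the origin, one occurrence per
  walk.\<close>

fun lazy_walk_mset :: "nat \<Rightarrow> nat \<Rightarrow> bit vec multiset" where
  "lazy_walk_mset n 0 = {#0\<^sub>v n#}"
| "lazy_walk_mset n (Suc r) = mset_conv (lazy_walk_mset n r) (lazy_step_mset n)"

lemma size_lazy_walk_mset [simp]: "size (lazy_walk_mset n r) = (2 * n) ^ r"
  by (induction r) auto

text \<open>Each step changes at most one coordinate. This is what keeps \<open>S\<close> within
  distance \<open>r\<close> of \<open>L\<close>.\<close>

lemma set_lazy_walk_mset: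
  "x \<in># lazy_walk_mset n r \<Longrightarrow> x \<in> carrier_vec n \<and> wt x \<le> r"
proof (induction r arbitrary: x)
  case (Suc r)
  then obtain y z where yz: "x = y + z" "y \<in># lazy_walk_mset n r" "z \<in># lazy_step_mset n"
    by (auto simp: set_mset_conv)
  moreover have "z \<in> carrier_vec n" using yz set_lazy_step_mset by blast
  ultimately show ?case
    using Suc.IH[of y] wt_add_le[of y n z] wt_lazy_step_mset[of z n] by auto
qed (auto simp: wt_def)

lemma char_sum_lazy_walk_mset:
  assumes "a \<in> carrier_vec n"
  shows "char_sum a (lazy_walk_mset n r) = (2 * (real n - real (wt a))) ^ r"
proof (induction r)
  case (Suc r)
  have "set_mset (lazy_walk_mset n r) \<subseteq> carrier_vec n"
    using set_lazy_walk_mset by blast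
  then have "char_sum a (lazy_walk_mset n (Suc r)) = char_sum a (lazy_walk_mset n r) * char_sum a (lazy_step_mset n)"
    by (simp add: char_sum_mset_conv[OF assms _ set_lazy_step_mset])
  then show ?case
    by (simp only: Suc char_sum_lazy_step_mset[OF assms] power_Suc2)
qed (use assms in simp)

section \<open>Subspaces whose dual avoids a given small set\<close>

text \<open>Averaging over all \<open>h\<close>: each fixed nonzero \<open>a\<close> is orthogonal to exactly half of them.\<close>

lemma exists_halving_vec:
  assumes B: "B \<subseteq> carrier_vec n" "0\<^sub>v n \<notin> B"
  obtains h :: "bit vec" where "h \<in> carrier_vec n" "2 * card {a \<in> B. h \<bullet> a = 0} \<le> card B"
proof -
  have fin: "finite B" using B(1) finite_carrier_bit_vec finite_subset by blast
  \<comment> \<open>The sum counts the elements of \<open>B\<close> orthogonal to \<open>h\<close>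
    minus the others, so it is at most 0 exactly when \<open>h\<close> halves
    \<open>B\<close>.\<close>
  have eq: "(\<Sum>a\<in>B. chi h a) = 2 * real (card {a \<in> B. h \<bullet> a = 0}) - real (card B)" for h
  proof -
    have "(\<Sum>a\<in>B. chi h a) = (\<Sum>a\<in>B. 2 * (if h \<bullet> a = 0 then 1 else 0) - 1)"
      by (intro sum.cong) (auto simp: chi_def)
    also have "\<dots> = 2 * (\<Sum>a\<in>B. if h \<bullet> a = 0 then 1 else 0) - real (card B)"
      by (simp only: sum_subtractf sum_distrib_left) simp
    also have "(\<Sum>a\<in>B. if h \<bullet> a = 0 then 1 else 0) = real (card {a \<in> B. h \<bullet> a = 0})"
      using fin by (subst sum.inter_filter[symmetric]) auto
    finally show ?thesis .
  qed
  have "(\<Sum>h\<in>carrier_vec n. \<Sum>a\<in>B. chi h a) = (\<Sum>a\<in>B. \<Sum>h\<in>carrier_vec n. chi h a)"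
    by (rule sum.swap)
  also have "\<dots> = (\<Sum>a\<in>B. \<Sum>h\<in>carrier_vec n. chi a h)"
    using B by (intro sum.cong refl chi_commute) auto
  also have "\<dots> = 0"
    using B by (intro sum.neutral) (auto simp: sum_chi_carrier_vec)
  finally have 0: "(\<Sum>h\<in>carrier_vec n. \<Sum>a\<in>B. chi h a) = 0" .
  have "\<exists>h\<in>carrier_vec n. (\<Sum>a\<in>B. chi h a) \<le> 0"
  proof (rule ccontr)
    assume "\<not> ?thesis"
    moreover have "(carrier_vec n :: bit vec set) \<noteq> {}" using zero_carrier_vec by blast
    ultimately have "(\<Sum>h\<in>carrier_vec n. \<Sum>a\<in>B. chi h a) > 0"
      by (intro sum_pos[OF finite_carrier_bit_vec]) (auto simp: not_le)
    with 0 show False by simp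
  qed
  then obtain h where "h \<in> carrier_vec n" "(\<Sum>a\<in>B. chi h a) \<le> 0" by blast
  then show thesis by (intro that[of h]) (simp_all add: eq)
qed

context vec_space
begin

text \<open>Lets orthogonality to \<open>a\<close> pass from a set of vectors to its span.\<close>

lemma orthogonal_submodule:
  assumes a: "a \<in> carrier_vec n"
  shows "submodule class_ring {x \<in> carrier_vec n. x \<bullet> a = 0} V"
  unfolding submodule_def
  using a by (auto simp: module_vec_simps vec_module add_scalar_prod_distrib[of _ n])

lemma lin_indpt_empty: "lin_indpt {}"
  by (simp add: lin_dep_def)

lemma dim_span_indep:
  assumes "H \<subseteq> carrier_vec n" "finite H" "lin_indpt H"
  shows "vectorspace.dim class_ring (vs (span H)) = card H"
  using assms vectorspace.dim_span[OF vec_vs, of H n H] by (auto simp: maximal_def)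

text \<open>Otherwise \<open>H\<close> would be a basis with fewer than \<open>n\<close>
  elements.\<close>

lemma exists_not_in_span:
  assumes "H \<subseteq> carrier_vec n" "finite H" "lin_indpt H" "card H < n"
  obtains h where "h \<in> carrier_vec n" "h \<notin> span H"
proof -
  have "span H \<noteq> carrier_vec n"
  proof
    assume "span H = carrier_vec n"
    then have "basis H" using assms by (simp add: basis_def)
    then show False using dim_basis assms dim_is_n by simp
  qed
  moreover have "span H \<subseteq> carrier_vec n" using assms span_is_subset2 by simp
  ultimately show thesis using that by blast
qed

end

text \<open>The independence of the halving vectors is free: a vector in the span of the previous ones
  kills no further element of \<open>B\<close>, so it cannot halve what is left unless nothing is left.\<close>

lemma exists_indep_separating:
  fixes B :: "bit vec set"
  assumes B: "B \<subseteq> carrier_vec n" "0\<^sub>v n \<notin> B" and "j \<le> n"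
  shows "\<exists>H. H \<subseteq> carrier_vec n \<and> finite H \<and> card H = j
           \<and> module.lin_indpt class_ring (F2_space n) H
           \<and> 2 ^ j * card {a \<in> B. \<forall>h\<in>H. h \<bullet> a = 0} \<le> card B"
  using \<open>j \<le> n\<close>
proof (induction j)
  interpret vec_space "TYPE(bit)" n .
  case 0
  show ?case
  proof (intro exI[of _ "{}"] conjI)
    show "lin_indpt {}" by (rule lin_indpt_empty)
  qed simp_all
next
  interpret vec_space "TYPE(bit)" n .
  case (Suc j)
  then obtain H where H: "H \<subseteq> carrier_vec n" "finite H" "card H = j" "lin_indpt H"
    and cardH: "2 ^ j * card {a \<in> B. \<forall>h\<in>H. h \<bullet> a = 0} \<le> card B"
    by (auto simp del: add_bit_eq_xor mult_bit_eq_and)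
  define R where "R = {a \<in> B. \<forall>h\<in>H. h \<bullet> a = 0}"
  have finR: "finite R"
    unfolding R_def using B(1) finite_carrier_bit_vec finite_subset by fastforce
  have "\<exists>h. h \<in> carrier_vec n \<and> h \<notin> span H \<and> 2 * card {a \<in> R. h \<bullet> a = 0} \<le> card R"
  proof (cases "R = {}")
    case True
    \<comment> \<open>Nothing is left to halve, so any vector outside the span serves; one exists
      because \<open>card H = j < n\<close>.\<close>
    with exists_not_in_span[of H] H Suc.prems show ?thesis by auto
  next
    case False
    obtain h where h: "h \<in> carrier_vec n" "2 * card {a \<in> R. h \<bullet> a = 0} \<le> card R"
      using exists_halving_vec[of R n] B by (auto simp: R_def)
    have "h \<notin> span H"
    proof
      assume hs: "h \<in> span H"
      have "h \<bullet> a = 0" if "a \<in> R" for a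
      proof -
        have "a \<in> carrier_vec n" "H \<subseteq> {x \<in> carrier_vec n. x \<bullet> a = 0}"
          using that B H by (auto simp: R_def)
        then show ?thesis
          using span_is_subset[OF _ orthogonal_submodule] hs by blast
      qed
      then have "{a \<in> R. h \<bullet> a = 0} = R" by auto
      with h(2) finR False show False by simp
    qed
    with h show ?thesis by blast
  qed
  then obtain h where h: "h \<in> carrier_vec n" "h \<notin> span H" "2 * card {a \<in> R. h \<bullet> a = 0} \<le> card R"
    by blast
  have "h \<notin> H" using h(2) H(1) in_own_span by auto
  have "lin_indpt (insert h H)"
    using lin_dep_iff_in_span[of H h] H h \<open>h \<notin> H\<close> by simp
  moreover have "{a \<in> B. \<forall>x\<in>insert h H. x \<bullet> a = 0} = {a \<in> R. h \<bullet> a = 0}"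
    by (auto simp: R_def)
  moreover have "2 ^ Suc j * card {a \<in> R. h \<bullet> a = 0} \<le> card B"
  proof -
    have "2 ^ Suc j * card {a \<in> R. h \<bullet> a = 0} = 2 ^ j * (2 * card {a \<in> R. h \<bullet> a = 0})"
      by simp
    also have "\<dots> \<le> 2 ^ j * card R" by (rule mult_le_mono2[OF h(3)])
    also have "\<dots> \<le> card B" using cardH by (simp only: R_def)
    finally show ?thesis .
  qed
  ultimately show ?case
    using H h \<open>h \<notin> H\<close> by (intro exI[of _ "insert h H"]) (auto simp del: add_bit_eq_xor mult_bit_eq_and)
qed

text \<open>After \<open>m\<close> halvings the number of survivors is an integer at most
  \<open>card B / 2 ^ m < 1\<close>, hence zero; \<open>L\<close> is the span of the halving
  vectors.\<close>

lemma exists_separating_subspace: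
  fixes B :: "bit vec set"
  assumes B: "B \<subseteq> carrier_vec n" "0\<^sub>v n \<notin> B" and m: "m \<le> n" "card B < 2 ^ m"
  obtains L where "F2_subspace n L" "F2_dim n L = m" "\<And>a. a \<in> B \<Longrightarrow> \<exists>u\<in>L. a \<bullet> u \<noteq> 0"
proof -
  interpret vec_space "TYPE(bit)" n .
  obtain H where H: "H \<subseteq> carrier_vec n" "finite H" "card H = m" "lin_indpt H"
    and cardH: "2 ^ m * card {a \<in> B. \<forall>h\<in>H. h \<bullet> a = 0} \<le> card B"
    using exists_indep_separating[OF B m(1)] by auto
  have "card {a \<in> B. \<forall>h\<in>H. h \<bullet> a = 0} = 0"
  proof (rule ccontr)
    assume "card {a \<in> B. \<forall>h\<in>H. h \<bullet> a = 0} \<noteq> 0"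
    then have "2 ^ m \<le> 2 ^ m * card {a \<in> B. \<forall>h\<in>H. h \<bullet> a = 0}" by simp
    with cardH m show False by linarith
  qed
  moreover have "finite {a \<in> B. \<forall>h\<in>H. h \<bullet> a = 0}"
    using B(1) finite_carrier_bit_vec finite_subset by fastforce
  ultimately have empty: "{a \<in> B. \<forall>h\<in>H. h \<bullet> a = 0} = {}" by simp
  show thesis
  proof (rule that[of "span H"])
    show "F2_subspace n (span H)"
      unfolding F2_subspace_def using H by (intro span_is_subspace) simp
    show "F2_dim n (span H) = m"
      unfolding F2_dim_def using dim_span_indep H by simp
  next
    fix a assume "a \<in> B"
    then obtain h where h: "h \<in> H" "h \<bullet> a \<noteq> 0" using empty by blast
    have "a \<bullet> h = h \<bullet> a"
      using \<open>a \<in> B\<close> B H h by (intro comm_scalar_prod[of _ n]) auto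
    moreover have "h \<in> span H" using h H in_own_span by auto
    ultimately show "\<exists>u\<in>span H. a \<bullet> u \<noteq> 0" using h by metis
  qed
qed

lemma F2_subspaceD:
  assumes "F2_subspace n L"
  shows "L \<subseteq> carrier_vec n" "0\<^sub>v n \<in> L" "\<And>x y. x \<in> L \<Longrightarrow> y \<in> L \<Longrightarrow> x + y \<in> L"
  using assms unfolding F2_subspace_def subspace_def submodule_def by (auto simp: module_vec_simps)

section \<open>Counting low-weight vectors\<close>

text \<open>The weight enumerator of the full space: expanding the product of \<open>n\<close>
  factors \<open>q + 1\<close> gives a term \<open>q ^ card X\<close> for each set \<open>X\<close>
  of coordinates, and distinct vectors have distinct supports.\<close>

lemma sum_power_wt_le:
  fixes q :: real
  assumes "q \<ge> 0"
  shows "(\<Sum>a\<in>carrier_vec n. q ^ wt a) \<le> (1 + q) ^ n"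
proof -
  let ?s = "\<lambda>x :: bit vec. {i. i < dim_vec x \<and> x $ i \<noteq> 0}"
  have "(\<Sum>a\<in>carrier_vec n. q ^ wt a) = (\<Sum>X\<in>?s ` carrier_vec n. q ^ card X)"
    unfolding sum.reindex[OF inj_on_support] comp_def wt_def ..
  also have "\<dots> \<le> (\<Sum>X\<in>Pow {..<n}. q ^ card X)"
    by (rule sum_mono2) (use assms in auto)
  also have "\<dots> = (\<Prod>i<n. q + 1)"
    by (simp only: prod_add[OF finite_lessThan]) simp
  finally show ?thesis by (simp add: add.commute)
qed

text \<open>Chernoff-type bound with the weight \<open>(1/8)\<^bsup>wt a\<^esup>\<close>; the 16th power avoids fractional exponents
  of \<open>n\<close>, and \<open>(9/8)\<^sup>1\<^sup>6 * 8 < 53 < 2\<^sup>8\<close>.\<close>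

lemma card_low_weight:
  "real (card {a \<in> carrier_vec n. 16 * wt a < n}) ^ 16 \<le> 53 ^ n"
proof -
  let ?B = "{a :: bit vec. a \<in> carrier_vec n \<and> 16 * wt a < n}"
  \<comment> \<open>Every element of \<open>?B\<close> has weight at most \<open>?t\<close>, hence
    contributes at least \<open>(1/8) ^ ?t\<close> to the weighted sum. Since
    \<open>16 * ?t \<le> n\<close>, the 16th power of \<open>8 ^ ?t\<close> is at most
    \<open>8 ^ n\<close>.\<close>
  let ?t = "n div 16"
  have "real (card ?B) * (1/8) ^ ?t = (\<Sum>a\<in>?B. (1/8) ^ ?t)" by simp
  also have "\<dots> \<le> (\<Sum>a\<in>?B. (1/8 :: real) ^ wt a)"
    by (intro sum_mono power_decreasing) auto
  also have "\<dots> \<le> (\<Sum>a\<in>carrier_vec n. (1/8 :: real) ^ wt a)"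
    by (intro sum_mono2) auto
  also have "\<dots> \<le> (9/8) ^ n" using sum_power_wt_le[of "1/8" n] by simp
  finally have "real (card ?B) \<le> (9/8) ^ n * 8 ^ ?t"
    by (simp add: field_simps power_divide)
  then have "real (card ?B) ^ 16 \<le> ((9/8) ^ n * 8 ^ ?t) ^ 16"
    by (rule power_mono) simp
  also have "\<dots> = ((9/8) ^ 16) ^ n * 8 ^ (16 * ?t)"
    by (simp only: power_mult_distrib power_mult[symmetric] mult.commute)
  also have "\<dots> \<le> ((9/8) ^ 16) ^ n * 8 ^ n"
    by (intro mult_left_mono power_increasing) auto
  also have "\<dots> = ((9/8) ^ 16 * 8) ^ n" by (simp only: power_mult_distrib)
  also have "\<dots> \<le> 53 ^ n" by (intro power_mono) (simp_all add: field_simps)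
  finally show ?thesis .
qed

text \<open>It suffices to compare 16th powers, that is \<open>53 ^ n\<close> with about
  \<open>256 ^ n\<close>.\<close>

lemma card_low_weight_less:
  assumes "n \<ge> 4"
  shows "card {a :: bit vec. a \<in> carrier_vec n \<and> 16 * wt a < n} < 2 ^ (n div 2)"
proof -
  let ?B = "{a :: bit vec. a \<in> carrier_vec n \<and> 16 * wt a < n}"
  \<comment> \<open>The spare factor 256 = 2^8 pays for the rounding in \<open>n div 2\<close> when
    \<open>n\<close> is odd; 4 is the first exponent at which the gap between 53 and 256 covers
    it.\<close>
  have "(256 :: real) * 53 ^ k < 256 ^ k" if "k \<ge> 4" for k :: nat
    using that
  proof (induction k rule: dec_induct)
    case (step k)
    moreover have "(0 :: real) < 53 ^ k" by simp
    ultimately show ?case unfolding power_Suc by linarith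
  qed simp
  then have "(256 :: real) * 53 ^ n < 256 ^ n" using assms .
  also have "(256 :: real) ^ n = 2 ^ (8 * n)" by (simp add: power_mult)
  also have "\<dots> \<le> 2 ^ (16 * (n div 2) + 8)" by (intro power_increasing) auto
  also have "\<dots> = 256 * (2 ^ (n div 2)) ^ 16"
    by (simp add: power_add power_mult[symmetric] mult.commute)
  finally have "real (card ?B) ^ 16 < (2 ^ (n div 2)) ^ 16"
    using card_low_weight[of n] by linarith
  then have "real (card ?B) < 2 ^ (n div 2)"
    by (rule power_less_imp_less_base) simp
  then show ?thesis by (metis of_nat_less_iff of_nat_numeral of_nat_power)
qed

section \<open>The spectrum of a Cayley graph of F_2^n\<close>

lemma vertex_list_props:
  assumes "finite (carrier H)"
  shows "distinct (vertex_list H)" "set (vertex_list H) = carrier H"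
proof -
  have "\<exists>vs. distinct vs \<and> set vs = carrier H"
    using finite_distinct_list[OF assms] by blast
  from someI_ex[OF this] show "distinct (vertex_list H)" "set (vertex_list H) = carrier H"
    by (simp_all add: vertex_list_def)
qed

text \<open>The left side is a row of the adjacency matrix applied to \<open>f\<close>. Each
  occurrence of \<open>s\<close> adds one edge from \<open>x\<close>, so regrouping by occurrences
  gives a form in which multiplicative functions are visibly eigenfunctions.\<close>

lemma sum_cayley_edges:
  fixes f :: "'a \<Rightarrow> real"
  assumes "finite (carrier H)" "\<And>s. s \<in># S \<Longrightarrow> x \<otimes>\<^bsub>H\<^esub> s \<in> carrier H"
  shows "(\<Sum>y\<in>carrier H. real (cayley_edges H S x y) * f y) = (\<Sum>s\<in>#S. f (x \<otimes>\<^bsub>H\<^esub> s))"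
  using assms(2)
proof (induction S)
  case empty
  then show ?case by (simp add: cayley_edges_def)
next
  case (add s S)
  have "(\<Sum>y\<in>carrier H. real (cayley_edges H (add_mset s S) x y) * f y)
      = (\<Sum>y\<in>carrier H. (if x \<otimes>\<^bsub>H\<^esub> s = y then f y else 0) + real (cayley_edges H S x y) * f y)"
    by (intro sum.cong) (auto simp: cayley_edges_def algebra_simps)
  also have "\<dots> = f (x \<otimes>\<^bsub>H\<^esub> s) + (\<Sum>y\<in>carrier H. real (cayley_edges H S x y) * f y)"
    using add.prems assms(1) by (simp add: sum.distrib)
  finally show ?case using add by simp
qed

lemma proots_prod_list_linear:
  "proots (\<Prod>a\<leftarrow>xs. [:- a, 1:]) = mset (xs :: complex list)"
proof (induction xs)
  case (Cons a xs)
  have "(\<Prod>a\<leftarrow>xs. [:- a, 1:]) \<noteq> (0 :: complex poly)"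
    by (auto simp: prod_list_zero_iff)
  with Cons show ?case by (simp only: list.map prod_list.Cons) (subst proots_mult, auto)
qed simp

text \<open>The columns of \<open>P\<close> form an eigenbasis, so \<open>A\<close> is similar to
  \<open>D\<close> and shares its characteristic polynomial. This determines the eigenvalues with
  multiplicity.\<close>

lemma proots_char_poly_eigenbasis:
  fixes A P Q D :: "complex mat"
  assumes "A \<in> carrier_mat k k" "P \<in> carrier_mat k k" "Q \<in> carrier_mat k k"
    and D: "D \<in> carrier_mat k k" "diagonal_mat D"
    and "P * Q = 1\<^sub>m k" "Q * P = 1\<^sub>m k" and AP: "A * P = P * D"
  shows "proots (char_poly A) = mset (diag_mat D)"
proof -
  have "A = A * (P * Q)" using assms by simp
  also have "\<dots> = A * P * Q" by (rule assoc_mult_mat[symmetric]) (rule assms)+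
  also have "\<dots> = P * D * Q" by (simp only: AP)
  finally have "similar_mat A D"
    using assms by (intro similar_matI[of _ _ P Q k]) auto
  then have "char_poly A = char_poly D" by (rule char_poly_similar)
  also have "upper_triangular D"
    using D by (auto simp: diagonal_mat_def upper_triangular_def)
  then have "char_poly D = (\<Prod>a\<leftarrow>diag_mat D. [:- a, 1:])"
    by (rule char_poly_upper_triangular[OF D(1)])
  finally show ?thesis by (simp only: proots_prod_list_linear)
qed

text \<open>The character table \<open>P\<close> diagonalizes the adjacency matrix of every Cayley
  graph of the group, whatever the order in which the vertices are listed.\<close>

lemma eigenvalue_abs_mset_cayley:
  assumes S: "set_mset S \<subseteq> carrier_vec n"
  shows "eigenvalue_abs_mset (cayley_adj_mat (F2_group n) S)
       = {#\<bar>char_sum a S\<bar>. a \<in># mset_set (carrier_vec n)#}"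
proof -
  let ?H = "F2_group n" and ?C = "carrier_vec n :: bit vec set"
  define vs where "vs = vertex_list ?H"
  define k where "k = length vs"
  have vs: "distinct vs" "set vs = ?C"
    using vertex_list_props[of ?H] by (simp_all add: vs_def monoid_vec_simps)
  have k: "k = card ?C" using vs by (metis distinct_card k_def)
  have bij: "bij_betw ((!) vs) {..<k} ?C"
    using bij_betw_nth[OF vs(1), of "{..<k}" ?C] vs by (simp add: k_def)
  have mem: "vs ! i \<in> ?C" if "i < k" for i
    using that vs by (metis k_def nth_mem)
  have sum_vs: "(\<Sum>i<k. f (vs ! i)) = (\<Sum>x\<in>?C. f x)" for f :: "bit vec \<Rightarrow> real"
    using sum.reindex_bij_betw[OF bij] .
  define A where "A = cayley_adj_mat ?H S"
  define P where "P = mat k k (\<lambda>(i, j). complex_of_real (chi (vs ! i) (vs ! j)))"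
  \<comment> \<open>By orthogonality of characters the symmetric matrix \<open>P\<close> has inverse
    \<open>P / k\<close>.\<close>
  define Q where "Q = mat k k (\<lambda>(i, j). complex_of_real (chi (vs ! i) (vs ! j) / k))"
  define D where "D = mat k k (\<lambda>(i, j). if i = j then complex_of_real (char_sum (vs ! i) S) else 0)"
  have A: "A = mat k k (\<lambda>(i, j). of_nat (cayley_edges ?H S (vs ! i) (vs ! j)))"
    by (simp add: A_def cayley_adj_mat_def Let_def vs_def k_def)
  have carr: "A \<in> carrier_mat k k" "P \<in> carrier_mat k k" "Q \<in> carrier_mat k k" "D \<in> carrier_mat k k"
    by (simp_all add: A P_def Q_def D_def)
  have mult: "(X * Y) $$ (i, j) = (\<Sum>l<k. X $$ (i, l) * Y $$ (l, j))"
    if "X \<in> carrier_mat k k" "Y \<in> carrier_mat k k" "i < k" "j < k" for X Y :: "complex mat" and i j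
    using that by (auto simp: times_mat_def scalar_prod_def lessThan_atLeast0 intro!: sum.cong)
  \<comment> \<open>The product of two characters is the character of the sum of their indices; in
    characteristic 2 that sum is zero only for equal indices.\<close>
  have orth: "(\<Sum>l<k. chi (vs ! i) (vs ! l) * chi (vs ! l) (vs ! j)) = (if i = j then real k else 0)"
    if ij: "i < k" "j < k" for i j
  proof -
    have "(\<Sum>l<k. chi (vs ! i) (vs ! l) * chi (vs ! l) (vs ! j))
        = (\<Sum>l<k. chi (vs ! i + vs ! j) (vs ! l))"
      using mem ij chi_add_left[of "vs ! i" n "vs ! j"] chi_commute[of _ n "vs ! j"]
      by (intro sum.cong refl) simp
    also have "\<dots> = (\<Sum>x\<in>?C. chi (vs ! i + vs ! j) x)" by (rule sum_vs)
    also have "\<dots> = (if vs ! i + vs ! j = 0\<^sub>v n then real k else 0)"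
      using mem ij by (subst sum_chi_carrier_vec) (auto simp: k)
    also have "vs ! i + vs ! j = 0\<^sub>v n \<longleftrightarrow> i = j"
      using mem ij vs(1) by (simp add: bit_vec_add_eq_0_iff nth_eq_iff_index_eq k_def)
    finally show ?thesis .
  qed
  have kpos: "k > 0" using k card_gt_0_iff[of ?C] zero_carrier_vec by fastforce
  have PQ: "P * Q = 1\<^sub>m k" and QP: "Q * P = 1\<^sub>m k"
  proof -
    have "(P * Q) $$ (i, j) = 1\<^sub>m k $$ (i, j)" "(Q * P) $$ (i, j) = 1\<^sub>m k $$ (i, j)"
      if ij: "i < k" "j < k" for i j
    proof -
      have "(P * Q) $$ (i, j) = of_real ((\<Sum>l<k. chi (vs ! i) (vs ! l) * chi (vs ! l) (vs ! j)) / k)"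
        unfolding mult[OF carr(2,3) ij] using ij by (simp add: P_def Q_def sum_divide_distrib)
      then show "(P * Q) $$ (i, j) = 1\<^sub>m k $$ (i, j)" using ij kpos by (simp only: orth) simp
      have "(Q * P) $$ (i, j) = of_real ((\<Sum>l<k. chi (vs ! i) (vs ! l) * chi (vs ! l) (vs ! j)) / k)"
        unfolding mult[OF carr(3,2) ij] using ij by (simp add: P_def Q_def sum_divide_distrib)
      then show "(Q * P) $$ (i, j) = 1\<^sub>m k $$ (i, j)" using ij kpos by (simp only: orth) simp
    qed
    then show "P * Q = 1\<^sub>m k" "Q * P = 1\<^sub>m k" using carr by (auto intro!: eq_matI)
  qed
  have "A * P = P * D"
  proof (rule eq_matI)
    fix i j assume "i < dim_row (P * D)" "j < dim_col (P * D)"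
    then have ij: "i < k" "j < k" using carr by auto
    have "(A * P) $$ (i, j)
        = of_real (\<Sum>l<k. real (cayley_edges ?H S (vs ! i) (vs ! l)) * chi (vs ! l) (vs ! j))"
      unfolding mult[OF carr(1,2) ij] using ij by (simp add: A P_def)
    also have "(\<Sum>l<k. real (cayley_edges ?H S (vs ! i) (vs ! l)) * chi (vs ! l) (vs ! j))
        = (\<Sum>y\<in>carrier ?H. real (cayley_edges ?H S (vs ! i) y) * chi y (vs ! j))"
      unfolding monoid_vec_simps by (rule sum_vs)
    also have "\<dots> = (\<Sum>s\<in>#S. chi (vs ! i \<otimes>\<^bsub>?H\<^esub> s) (vs ! j))"
      using S mem ij by (intro sum_cayley_edges) (auto simp: monoid_vec_simps)
    \<comment> \<open>Multiplicativity of the character splits off its value at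
      \<open>vs ! i\<close>; what remains is the eigenvalue.\<close>
    also have "\<dots> = (\<Sum>s\<in>#S. chi (vs ! i) (vs ! j) * chi (vs ! j) s)"
    proof -
      have "chi (vs ! i + s) (vs ! j) = chi (vs ! i) (vs ! j) * chi (vs ! j) s" if "s \<in># S" for s
        using that S mem ij chi_add_left[of "vs ! i" n s "vs ! j"] chi_commute[of s n "vs ! j"] by auto
      then show ?thesis
        by (intro arg_cong[where f=sum_mset] image_mset_cong) (simp add: monoid_vec_simps)
    qed
    also have "\<dots> = chi (vs ! i) (vs ! j) * char_sum (vs ! j) S"
      by (simp add: char_sum_def sum_mset_distrib_left multiset.map_comp comp_def)
    also have "of_real \<dots> = (P * D) $$ (i, j)"
      unfolding mult[OF carr(2,4) ij] using ij by (simp add: P_def D_def if_distrib[of "\<lambda>x. _ * x"] cong: if_cong)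
    finally show "(A * P) $$ (i, j) = (P * D) $$ (i, j)" .
  qed (use carr in auto)
  moreover have "diagonal_mat D" by (auto simp: diagonal_mat_def D_def)
  ultimately have "proots (char_poly A) = mset (diag_mat D)"
    using carr PQ QP by (intro proots_char_poly_eigenbasis) auto
  also have "diag_mat D = map (\<lambda>a. complex_of_real (char_sum a S)) vs"
    by (rule nth_equalityI) (auto simp: diag_mat_def D_def k_def)
  finally have "eigenvalue_abs_mset A = image_mset (\<lambda>a. \<bar>char_sum a S\<bar>) (mset vs)"
    by (simp add: eigenvalue_abs_mset_def multiset.map_comp comp_def)
  also have "mset vs = mset_set ?C" using vs by (metis mset_set_set)
  finally show ?thesis by (simp only: A_def)
qed

section \<open>From the spectrum to the normalized second eigenvalue\<close>

text \<open>As \<open>x\<close> bounds \<open>M\<close>, it goes to the end of the sorted list, so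
  index 1 of the reversed list is the maximum of \<open>M\<close>.\<close>

lemma second_largest_add_mset_le:
  assumes "M \<noteq> {#}" "\<And>y. y \<in># M \<Longrightarrow> y \<le> x" "\<And>y. y \<in># M \<Longrightarrow> y \<le> e"
  shows "second_largest (add_mset x M) \<le> e"
proof -
  let ?xs = "sorted_list_of_multiset M"
  have "sorted (?xs @ [x])" using assms(2) by (simp add: sorted_append)
  then have "sort (?xs @ [x]) = ?xs @ [x]" by (rule sorted_sort_id)
  moreover have "add_mset x M = mset (?xs @ [x])" by simp
  ultimately have "sorted_list_of_multiset (add_mset x M) = ?xs @ [x]"
    by (simp only: sorted_list_of_multiset_mset)
  then have "second_largest (add_mset x M) = rev ?xs ! 0"
    by (simp add: second_largest_def)
  also have "rev ?xs \<noteq> []" using assms(1) mset_sorted_list_of_multiset[of M] by force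
  then have "rev ?xs ! 0 \<in> set (rev ?xs)" by (intro nth_mem) simp
  then have "rev ?xs ! 0 \<in># M" by simp
  finally show ?thesis using assms(3) by blast
qed

text \<open>The zero index gives the degree \<open>size S\<close>, which dominates all other
  character sums; so the second largest value comes from a nonzero index.\<close>

lemma cayley_lambda_le:
  assumes n: "n > 0" and S: "set_mset S \<subseteq> carrier_vec n" "S \<noteq> {#}"
    and bound: "\<And>a. a \<in> carrier_vec n \<Longrightarrow> a \<noteq> 0\<^sub>v n \<Longrightarrow> \<bar>char_sum a S\<bar> \<le> e * real (size S)"
  shows "cayley_lambda (F2_group n) S \<le> e"
proof -
  let ?C = "carrier_vec n :: bit vec set"
  define M where "M = {#\<bar>char_sum a S\<bar>. a \<in># mset_set (?C - {0\<^sub>v n})#}"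
  have "mset_set ?C = add_mset (0\<^sub>v n) (mset_set (?C - {0\<^sub>v n}))"
    by (rule mset_set.remove) auto
  then have eq: "eigenvalue_abs_mset (cayley_adj_mat (F2_group n) S) = add_mset (real (size S)) M"
    by (simp add: eigenvalue_abs_mset_cayley S(1) M_def char_sum_zero)
  \<comment> \<open>Positive \<open>n\<close> provides a nonzero index, so that an entry at position
    1 exists.\<close>
  have "unit_vec n 0 \<in> ?C - {0\<^sub>v n}" using n by simp
  then have "?C - {0\<^sub>v n} \<noteq> {}" by blast
  then have "M \<noteq> {#}" by (simp add: M_def mset_set_empty_iff del: Diff_eq_empty_iff)
  then have "second_largest (add_mset (real (size S)) M) \<le> e * real (size S)"
    by (rule second_largest_add_mset_le) (auto simp: M_def abs_char_sum_le intro: bound)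
  moreover have "real (size S) > 0" using S(2) by (simp add: nonempty_has_size)
  ultimately show ?thesis by (simp add: cayley_lambda_def eq pos_divide_le_eq)
qed

lemma symmetric_mset_F2_group:
  assumes "set_mset S \<subseteq> carrier_vec n"
  shows "symmetric_mset (F2_group n) S"
proof -
  interpret comm_group "F2_group n" by (rule comm_group_vec)
  have "inv\<^bsub>F2_group n\<^esub> x = x" if "x \<in># S" for x
    using that assms by (intro inv_equality) (auto simp: monoid_vec_simps)
  then have "image_mset (\<lambda>s. inv\<^bsub>F2_group n\<^esub> s) S = image_mset (\<lambda>s. s) S"
    by (rule image_mset_cong)
  with assms show ?thesis by (simp add: symmetric_mset_def monoid_vec_simps)
qed

section \<open>Walk length and the final construction\<close>

text \<open>Since \<open>15/16 \<le> exp (-1/16)\<close>, an exponent of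
  \<open>16 * c * ln n\<close> would do. The floor loses at most 1, which the surplus
  \<open>4 * c * ln n\<close> covers.\<close>

lemma power_nat_floor_le_powr:
  fixes c :: real
  assumes "c > 0" "n \<ge> 1" "1 \<le> 4 * c * ln (real n)"
  shows "(15 / 16) ^ nat \<lfloor>20 * c * ln (real n)\<rfloor> \<le> 1 / real n powr c"
proof -
  let ?r = "nat \<lfloor>20 * c * ln (real n)\<rfloor>"
  have r: "real ?r \<ge> 20 * c * ln (real n) - 1" by linarith
  have "(15 / 16 :: real) ^ ?r \<le> exp (- 1 / 16) ^ ?r"
    using exp_ge_add_one_self[of "- 1 / 16"] by (intro power_mono) simp_all
  also have "\<dots> = exp (- (real ?r / 16))" by (simp add: exp_of_nat_mult[symmetric])
  also have "c * ln (real n) \<le> real ?r / 16" using r assms(3) by linarith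
  then have "exp (- (real ?r / 16)) \<le> exp (- (c * ln (real n)))" by simp
  also have "\<dots> = 1 / real n powr c" using assms(2) by (simp add: powr_def exp_minus divide_simps)
  finally show ?thesis .
qed

theorem theorem6p2:
  fixes c :: real
  assumes "c > 0"
  shows "\<exists>N. \<forall>n\<ge>N. \<exists>S.
           S \<noteq> {#} \<and> symmetric_mset (F2_group n) S
           \<and> cayley_lambda (F2_group n) S \<le> 1 / real n powr c
           \<and> (\<exists>L. F2_subspace n L \<and> F2_dim n L = n div 2
                  \<and> set_mset S \<subseteq> F2_nbhd n L (20 * c * ln (real n)))"
proof -
  \<comment> \<open>This threshold yields \<open>4 * c * ln n \<ge> 1\<close>, the surplus that
    absorbs the floor; the 4 in \<open>max 4 N0\<close> comes from the counting of low-weight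
    vectors.\<close>
  obtain N0 :: nat where N0: "real N0 \<ge> exp (1 / (4 * c))" using real_arch_simple by blast
  show ?thesis
  proof (intro exI[of _ "max 4 N0"] allI impI)
    fix n assume "n \<ge> max 4 N0"
    then have n: "n \<ge> 4" "real n \<ge> exp (1 / (4 * c))" using N0 by auto
    have "1 / (4 * c) \<le> ln (real n)" using n by (subst ln_ge_iff) auto
    then have ln: "1 \<le> 4 * c * ln (real n)" using assms by (simp add: field_simps)
    define r where "r = nat \<lfloor>20 * c * ln (real n)\<rfloor>"
    have r: "real r \<le> 20 * c * ln (real n)" using ln by (simp add: r_def)
    \<comment> \<open>The vectors to be kept out of the dual of \<open>L\<close>; zero is removed
      because it is orthogonal to everything.\<close>
    let ?B = "{a :: bit vec. a \<in> carrier_vec n \<and> 16 * wt a < n} - {0\<^sub>v n}"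
    have "card ?B \<le> card {a :: bit vec. a \<in> carrier_vec n \<and> 16 * wt a < n}"
      by (intro card_mono) auto
    then have "card ?B < 2 ^ (n div 2)" using card_low_weight_less[OF n(1)] by linarith
    then obtain L where L: "F2_subspace n L" "F2_dim n L = n div 2"
      and sep: "\<And>a. a \<in> ?B \<Longrightarrow> \<exists>u\<in>L. a \<bullet> u \<noteq> 0"
      using exists_separating_subspace[of ?B n "n div 2"] by auto
    note L' = F2_subspaceD[OF L(1)]
    have finL: "finite L" using L'(1) finite_carrier_bit_vec finite_subset by blast
    define W where "W = lazy_walk_mset n r"
    have W: "set_mset W \<subseteq> carrier_vec n" "size W = (2 * n) ^ r"
      using set_lazy_walk_mset by (auto simp: W_def)
    define S where "S = mset_conv (mset_set L) W"
    have size_S: "size S = card L * (2 * n) ^ r" by (simp add: S_def W)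
    have S: "set_mset S \<subseteq> carrier_vec n"
      using L'(1) finL W(1) by (auto simp: S_def set_mset_conv intro!: add_carrier_vec)
    have "card L > 0" using L'(2) finL card_gt_0_iff by blast
    then have "size S > 0" using n by (simp add: size_S)
    then have "S \<noteq> {#}" by auto
    have "\<bar>char_sum a S\<bar> \<le> 1 / real n powr c * real (size S)"
      if a: "a \<in> carrier_vec n" "a \<noteq> 0\<^sub>v n" for a
    proof -
      have eq: "char_sum a S = (\<Sum>u\<in>L. chi a u) * (2 * (real n - real (wt a))) ^ r"
        using char_sum_mset_conv[OF a(1), of "mset_set L" W] W L'(1) finL
          char_sum_lazy_walk_mset[OF a(1), of r] by (simp add: S_def W_def)
      show ?thesis
      proof (cases "\<exists>u\<in>L. a \<bullet> u \<noteq> 0")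
        case True
        then have "char_sum a S = 0"
          using sum_chi_eq_0[OF L'(1,3) a(1)] eq by auto
        then show ?thesis by simp
      next
        case False
        \<comment> \<open>A nonzero vector in the dual of \<open>L\<close> has weight at least
          \<open>n/16\<close>, which gives the factor \<open>15/16\<close> per step of the
          walk.\<close>
        then have "a \<notin> ?B" using sep by blast
        then have wt: "n \<le> 16 * wt a" using a by auto
        have "(\<Sum>u\<in>L. chi a u) = real (card L)" using False by (simp add: chi_def)
        then have "\<bar>char_sum a S\<bar> = real (card L) * (2 * (real n - real (wt a))) ^ r"
          using wt_le[OF a(1)] by (simp add: eq abs_mult power_abs)
        also have "\<dots> \<le> real (card L) * (15 / 16 * (2 * real n)) ^ r"
          using wt wt_le[OF a(1)] by (intro mult_left_mono power_mono) auto
        also have "\<dots> = (15 / 16) ^ r * real (size S)"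
          by (simp only: size_S power_mult_distrib of_nat_mult of_nat_power of_nat_numeral ac_simps)
        also have "\<dots> \<le> 1 / real n powr c * real (size S)"
          using power_nat_floor_le_powr[OF assms _ ln] n by (intro mult_right_mono) (auto simp: r_def)
        finally show ?thesis .
      qed
    qed
    then have "cayley_lambda (F2_group n) S \<le> 1 / real n powr c"
      using n S \<open>S \<noteq> {#}\<close> by (intro cayley_lambda_le) auto
    moreover have "set_mset S \<subseteq> F2_nbhd n L (20 * c * ln (real n))"
    proof
      fix x assume "x \<in># S"
      then obtain u y where uy: "x = u + y" "u \<in> L" "y \<in># W"
        using finL by (auto simp: S_def set_mset_conv)
      moreover have "y \<in> carrier_vec n" "real (wt y) \<le> 20 * c * ln (real n)"
        using set_lazy_walk_mset[of y n r] uy r by (auto simp: W_def)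
      ultimately show "x \<in> F2_nbhd n L (20 * c * ln (real n))"
        unfolding F2_nbhd_def by blast
    qed
    ultimately show "\<exists>S. S \<noteq> {#} \<and> symmetric_mset (F2_group n) S
           \<and> cayley_lambda (F2_group n) S \<le> 1 / real n powr c
           \<and> (\<exists>L. F2_subspace n L \<and> F2_dim n L = n div 2
                  \<and> set_mset S \<subseteq> F2_nbhd n L (20 * c * ln (real n)))"
      using \<open>S \<noteq> {#}\<close> symmetric_mset_F2_group[OF S] L by blast
  qed
qed

end
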